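(* Let $(K,v)$ be a field with valuation with value group $\Gamma$, let $w\in\Gamma^n$, let $\prec$ be a monomial order on $K[x_1,\ldots,x_n]$, and let $d\ge1$. Let $K[x_1,\ldots,x_n]^d/I$ be a finitely generated graded module, where $I\subseteq K[x_1,\ldots,x_n]^d$ is a submodule generated by homogeneous elements. Then the Hilbert functions of $K[x_1,\ldots,x_n]^d/I$ and $K[x_1,\ldots,x_n]^d/\operatorname{in}_{w,\prec}(I)$ are the same.
   Context: A field with valuation is a field $K$ with a function $v:K\to\mathbb{R}\cup\{\infty\}$ such that $v$ restricts to a group homomorphism $K^*\to(\mathbb{R},+)$, $v(a+b)\ge\min\{v(a),v(b)\}$, and $v(a)=\infty$ iff $a=0$. Its value group is $\Gamma=v(K^* )$. Let $e_1,\ldots,e_d$ be the standard basis. Every element of $K[x_1,\ldots,x_n]^d$ is a finite sum $f=\sum c_{u,k}x^ue_k$; $c_{u,k}x^ue_k$ is called a term, $x^ue_k$ a monomial, of degree $|u|=u_1+\cdots+u_n$, and $\operatorname{supp}(f)=\{(u,k):c_{u,k}\ne0\}$. An element is homogeneous if all its monomials have the same degree; gradings are with respect to this degree. The Hilbert function of a graded module $N=\bigoplus_{\delta\in\mathbb{N}}N_\delta$ is $\delta\mapsto\dim_KN_\delta$. Monomials are ordered by: $x^\alpha e_i\prec x^\beta e_j$ if $x^\alpha\prec x^\beta$, or $x^\alpha=x^\beta$ and $e_i\prec e_j$, where $e_1\prec\cdots\prec e_d$. For $f\ne0$ put $W=\min_{(u,k)\in\operatorname{supp}(f)}\{v(c_{u,k})+w\cdot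 u\}$; then $\operatorname{in}_{w,\prec}(f)$ is the term $c_{u,k}x^ue_k$ of $f$ whose monomial is the $\prec$-largest among those with $v(c_{u,k})+w\cdot u=W$; $\operatorname{in}_{w,\prec}(0)=0$. For a submodule $I$, $\operatorname{in}_{w,\prec}(I)$ is the submodule $\langle\operatorname{in}_{w,\prec}(f):f\in I\rangle$ of $K[x_1,\ldots,x_n]^d$. *)

theory Defs
  imports
    "HOL-Analysis.Analysis"
    "HOL-Library.Poly_Mapping"
    "HOL-Library.Set_Algebras"
    "Jordan_Normal_Form.Missing_VectorSpace"
begin

section \<open>Fields with valuation\<close>

text \<open>The codomain $\mathbb{R}\cup\{\infty\}$ is \<^typ>\<open>ereal\<close> with $-\infty$ excluded by the
  first and last conjuncts.\<close>

definition valuation :: "('k::field \<Rightarrow> ereal) \<Rightarrow> bool" where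
  "valuation v \<longleftrightarrow>
     (\<forall>a. a \<noteq> 0 \<longrightarrow> \<bar>v a\<bar> \<noteq> \<infinity>) \<and>
     (\<forall>a b. a \<noteq> 0 \<longrightarrow> b \<noteq> 0 \<longrightarrow> v (a * b) = v a + v b) \<and>
     (\<forall>a b. v (a + b) \<ge> min (v a) (v b)) \<and>
     (\<forall>a. v a = \<infinity> \<longleftrightarrow> a = 0)"

definition value_group :: "('k::field \<Rightarrow> ereal) \<Rightarrow> real set" where
  "value_group v = {r. \<exists>a. a \<noteq> 0 \<and> v a = ereal r}"


section \<open>Polynomial vectors\<close>

text \<open>The variables are indexed by a finite type \<open>'n\<close> and the basis vectors $e_k$ by a finite
  linearly ordered type \<open>'d\<close>. An exponent vector is a map \<open>'n \<Rightarrow>\<^sub>0 nat\<close>, and the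
  multiplication on \<open>('n, 'k) mpoly\<close> is the convolution product of \<^theory>\<open>HOL-Library.Poly_Mapping\<close>.\<close>

type_synonym ('n, 'k) mpoly = "('n \<Rightarrow>\<^sub>0 nat) \<Rightarrow>\<^sub>0 'k"

interpretation free_mod: Modules.module "(*s) :: 'r::comm_ring_1 \<Rightarrow> 'r ^ 'd \<Rightarrow> 'r ^ 'd"
  by standard (simp_all add: vector_scalar_mult_def vec_eq_iff algebra_simps)

abbreviation const :: "'k::zero \<Rightarrow> ('n, 'k) mpoly" where
  "const c \<equiv> Poly_Mapping.single 0 c"

definition coeff_at :: "('n, 'k::zero) mpoly ^ 'd \<Rightarrow> ('n \<Rightarrow>\<^sub>0 nat) \<times> 'd \<Rightarrow> 'k" where
  "coeff_at f m = Poly_Mapping.lookup (f $ snd m) (fst m)"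

definition supp :: "('n, 'k::zero) mpoly ^ 'd \<Rightarrow> (('n \<Rightarrow>\<^sub>0 nat) \<times> 'd) set" where
  "supp f = {m. coeff_at f m \<noteq> 0}"

text \<open>The term $c\,x^u e_k$ for $m = (u, k)$.\<close>

definition term_vec :: "'k::zero \<Rightarrow> ('n \<Rightarrow>\<^sub>0 nat) \<times> 'd \<Rightarrow> ('n, 'k) mpoly ^ 'd" where
  "term_vec c m = axis (snd m) (Poly_Mapping.single (fst m) c)"

definition mdeg :: "('n::finite \<Rightarrow>\<^sub>0 nat) \<Rightarrow> nat" where
  "mdeg u = (\<Sum>i\<in>UNIV. Poly_Mapping.lookup u i)"

definition homogeneous_of_degree :: "nat \<Rightarrow> ('n::finite, 'k::zero) mpoly ^ 'd \<Rightarrow> bool" where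
  "homogeneous_of_degree \<delta> f \<longleftrightarrow> (\<forall>(u, k)\<in>supp f. mdeg u = \<delta>)"

definition homogeneous :: "('n::finite, 'k::zero) mpoly ^ 'd \<Rightarrow> bool" where
  "homogeneous f \<longleftrightarrow> (\<exists>\<delta>. homogeneous_of_degree \<delta> f)"


section \<open>Monomial orders and initial submodules\<close>

text \<open>An order on the monomials $x^u$ is given by its strict part on exponent vectors.\<close>

definition monomial_order :: "(('n \<Rightarrow>\<^sub>0 nat) \<Rightarrow> ('n \<Rightarrow>\<^sub>0 nat) \<Rightarrow> bool) \<Rightarrow> bool" where
  "monomial_order prec \<longleftrightarrow>
     irreflp prec \<and> transp prec \<and> totalp prec \<and> wfp prec \<and>
     (\<forall>a b c. prec a b \<longrightarrow> prec (a + c) (b + c))"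

definition vec_monomial_less ::
    "(('n \<Rightarrow>\<^sub>0 nat) \<Rightarrow> ('n \<Rightarrow>\<^sub>0 nat) \<Rightarrow> bool) \<Rightarrow>
     ('n \<Rightarrow>\<^sub>0 nat) \<times> 'd::linorder \<Rightarrow> ('n \<Rightarrow>\<^sub>0 nat) \<times> 'd \<Rightarrow> bool" where
  "vec_monomial_less prec m m' \<longleftrightarrow>
     prec (fst m) (fst m') \<or> fst m = fst m' \<and> snd m < snd m'"

definition weight ::
    "('k \<Rightarrow> ereal) \<Rightarrow> real ^ 'n \<Rightarrow> ('n, 'k::zero) mpoly ^ 'd \<Rightarrow> ('n \<Rightarrow>\<^sub>0 nat) \<times> 'd \<Rightarrow> ereal" where
  "weight v w f m = v (coeff_at f m) + ereal (\<Sum>i\<in>UNIV. w $ i * real (Poly_Mapping.lookup (fst m) i))"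

definition min_weight ::
    "('k \<Rightarrow> ereal) \<Rightarrow> real ^ 'n \<Rightarrow> ('n, 'k::zero) mpoly ^ 'd \<Rightarrow> ereal" where
  "min_weight v w f = Min (weight v w f ` supp f)"

definition initial_monomial ::
    "('k \<Rightarrow> ereal) \<Rightarrow> real ^ 'n \<Rightarrow> (('n \<Rightarrow>\<^sub>0 nat) \<Rightarrow> ('n \<Rightarrow>\<^sub>0 nat) \<Rightarrow> bool) \<Rightarrow>
     ('n, 'k::zero) mpoly ^ 'd::{finite,linorder} \<Rightarrow> ('n \<Rightarrow>\<^sub>0 nat) \<times> 'd" where
  "initial_monomial v w prec f =
     (THE m. m \<in> supp f \<and> weight v w f m = min_weight v w f \<and>
        (\<forall>m'\<in>supp f. weight v w f m' = min_weight v w f \<longrightarrow>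
           m' = m \<or> vec_monomial_less prec m' m))"

definition initial_term ::
    "('k \<Rightarrow> ereal) \<Rightarrow> real ^ 'n \<Rightarrow> (('n \<Rightarrow>\<^sub>0 nat) \<Rightarrow> ('n \<Rightarrow>\<^sub>0 nat) \<Rightarrow> bool) \<Rightarrow>
     ('n, 'k::zero) mpoly ^ 'd::{finite,linorder} \<Rightarrow> ('n, 'k) mpoly ^ 'd::{finite,linorder}" where
  "initial_term v w prec f =
     (if f = 0 then 0
      else let m = initial_monomial v w prec f in term_vec (coeff_at f m) m)"

definition initial_submodule ::
    "('k \<Rightarrow> ereal) \<Rightarrow> real ^ 'n \<Rightarrow> (('n \<Rightarrow>\<^sub>0 nat) \<Rightarrow> ('n \<Rightarrow>\<^sub>0 nat) \<Rightarrow> bool) \<Rightarrow>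
     (('n, 'k::comm_ring_1) mpoly ^ 'd::{finite,linorder}) set \<Rightarrow> (('n, 'k) mpoly ^ 'd::{finite,linorder}) set" where
  "initial_submodule v w prec I = free_mod.span (initial_term v w prec ` I)"


section \<open>Hilbert functions of quotients\<close>

abbreviation field_ring :: "'k::field ring" where
  "field_ring \<equiv> \<lparr>carrier = UNIV, mult = (*), one = 1, zero = 0, add = (+)\<rparr>"

text \<open>The degree-\<open>\<delta>\<close> part of $K[x_1,\dots,x_n]^d/I$, as a $K$-vector space of cosets
  \<^term>\<open>f +o I\<close>; the sum of cosets is the elementwise sum of sets. Scalar multiplication adds
  \<^term>\<open>I\<close> so that $0\cdot(f+I)$ is the coset $I$ and not $\{0\}$. The record fields \<open>mult\<close> and \<open>one\<close>
  are not part of the module structure.\<close>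

definition quotient_piece ::
    "(('n::finite, 'k::field) mpoly ^ 'd) set \<Rightarrow> nat \<Rightarrow> ('k, (('n, 'k) mpoly ^ 'd) set) module" where
  "quotient_piece I \<delta> =
     \<lparr>carrier = (\<lambda>f. f +o I) ` {f. homogeneous_of_degree \<delta> f},
      mult = undefined, one = undefined,
      zero = I, add = (+),
      smult = (\<lambda>c A. (\<lambda>f. const c *s f) ` A + I)\<rparr>"

definition hilbert_function :: "(('n::finite, 'k::field) mpoly ^ 'd) set \<Rightarrow> nat \<Rightarrow> nat" where
  "hilbert_function I \<delta> = vectorspace.dim field_ring (quotient_piece I \<delta>)"

end

theory Submission
  imports Defs
begin

text \<open>Let \<open>S\<close> be the set of initial monomials of elements of \<open>I\<close>. It is closed under multiplication
  by monomials, so the initial submodule consists of all vectors supported in \<open>S\<close>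
  (\<open>initial_submodule_eq\<close>). Call the monomials outside \<open>S\<close> standard. In each degree \<open>\<delta>\<close> the standard
  monomials are a basis of the quotient by the initial submodule, and the claim is that they are also
  a basis of the quotient by \<open>I\<close>; then both Hilbert functions count them.

  The standard monomials are independent modulo \<open>I\<close>, since a nonzero element of \<open>I\<close> contains a monomial
  of \<open>S\<close>. That they generate is usually shown by division with remainder, but with weights involving a
  valuation this process need not stop: cancelling one term may create others of larger weight, without
  end. Instead one counts dimensions. Pick in \<open>I\<close>, for
  every \<open>m \<in> S\<close> of degree \<open>\<delta>\<close>, a homogeneous vector with initial monomial \<open>m\<close>; it exists because \<open>I\<close>
  contains the homogeneous components of its elements (\<open>degree_part_in_span\<close>). Together with the
  standard monomials these vectors have distinct initial monomials, one for each monomial of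
  degree \<open>\<delta>\<close>. Vectors with distinct initial monomials are independent
  (\<open>trivial_if_combination_zero\<close>), by the ultrametric inequality applied to the coefficient at the
  initial monomial of the sum of their initial terms. So they are a basis
  of the finite-dimensional space of vectors of degree \<open>\<delta>\<close> (\<open>span_if_kernel_trivial\<close>), and modulo \<open>I\<close>
  only the standard monomials are left.\<close>

section \<open>Coefficients of polynomial vectors\<close>

lemma coeff_at_add: "coeff_at (f + g) m = coeff_at f m + (coeff_at g m :: 'k::comm_ring_1)"
  by (simp add: coeff_at_def lookup_add)

lemma coeff_at_minus: "coeff_at (f - g) m = coeff_at f m - (coeff_at g m :: 'k::comm_ring_1)"
  by (simp add: coeff_at_def lookup_minus)

lemma coeff_at_zero: "coeff_at 0 m = 0"
  by (simp add: coeff_at_def)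

lemma coeff_at_sum: "coeff_at (\<Sum>x\<in>A. f x) m = (\<Sum>x\<in>A. coeff_at (f x) m :: 'k::comm_ring_1)"
  by (induction A rule: infinite_finite_induct) (simp_all add: coeff_at_zero coeff_at_add)

lemma coeff_at_term_vec: "coeff_at (term_vec c m) m' = (if m' = m then c else 0)"
  by (auto simp: coeff_at_def term_vec_def axis_def lookup_single when_def prod_eq_iff)

lemma lookup_single_times_shift:
  fixes p :: "('n, 'k::comm_ring_1) mpoly"
  shows "Poly_Mapping.lookup (Poly_Mapping.single u c * p) (u + t) = c * Poly_Mapping.lookup p t"
proof -
  have "Poly_Mapping.lookup (Poly_Mapping.single u c * p) (u + t) =
     Sum_any (\<lambda>l. Poly_Mapping.lookup (Poly_Mapping.single u c) l *
       Sum_any (\<lambda>q. Poly_Mapping.lookup p q when u + t = l + q))"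
    by (rule lookup_mult)
  also have "\<dots> = Sum_any (\<lambda>l. c * Sum_any (\<lambda>q. Poly_Mapping.lookup p q when u + t = u + q) when l = u)"
    by (intro Sum_any.cong) (simp add: lookup_single when_def)
  also have "\<dots> = c * Sum_any (\<lambda>q. Poly_Mapping.lookup p q when q = t)"
    by (simp add: eq_commute)
  finally show ?thesis by simp
qed

lemma lookup_single_times_outside:
  fixes p :: "('n, 'k::comm_ring_1) mpoly"
  assumes "\<And>t. s \<noteq> u + t"
  shows "Poly_Mapping.lookup (Poly_Mapping.single u c * p) s = 0"
proof -
  have "Poly_Mapping.lookup (Poly_Mapping.single u c) l *
      Sum_any (\<lambda>q. Poly_Mapping.lookup p q when s = l + q) = 0" for l
    using assms by (cases "l = u") (simp_all add: lookup_single)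
  then show ?thesis by (simp add: lookup_mult)
qed

definition shift_monomial :: "('n \<Rightarrow>\<^sub>0 nat) \<Rightarrow> ('n \<Rightarrow>\<^sub>0 nat) \<times> 'd \<Rightarrow> ('n \<Rightarrow>\<^sub>0 nat) \<times> 'd" where
  "shift_monomial u m = (u + fst m, snd m)"

lemma coeff_at_single_scale_shift: "coeff_at (Poly_Mapping.single u c *s f) (shift_monomial u m) = (c :: 'k::comm_ring_1) * coeff_at f m"
  by (simp add: coeff_at_def shift_monomial_def lookup_single_times_shift)

lemma coeff_at_single_scale_outside: "m \<notin> range (shift_monomial u) \<Longrightarrow> coeff_at (Poly_Mapping.single u (c :: 'k::comm_ring_1) *s f) m = 0"
proof -
  assume a: "m \<notin> range (shift_monomial u)"
  have "fst m \<noteq> u + t" for t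
    using a rangeI[of "shift_monomial u" "(t, snd m)"] by (cases m) (auto simp: shift_monomial_def)
  then show ?thesis by (simp add: coeff_at_def lookup_single_times_outside)
qed

lemma coeff_at_const_scale: "coeff_at (const c *s f) m = (c :: 'k::comm_ring_1) * coeff_at f m"
  using coeff_at_single_scale_shift[of 0 c f m] by (simp add: shift_monomial_def)

lemma vec_eqI_coeff_at: "(\<And>m. coeff_at f m = coeff_at g m) \<Longrightarrow> f = g"
  by (auto simp: coeff_at_def vec_eq_iff intro!: poly_mapping_eqI)

lemma finite_supp: "finite (supp f)"
proof -
  have "supp f \<subseteq> (\<Union>k. Poly_Mapping.keys (f $ k) \<times> {k})"
    by (auto simp: supp_def coeff_at_def in_keys_iff)
  then show ?thesis by (rule finite_subset) auto
qed

lemma supp_eq_empty_iff: "supp f = {} \<longleftrightarrow> f = 0"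
  by (auto simp: supp_def coeff_at_zero intro!: vec_eqI_coeff_at)

lemma supp_term_vec: "supp (term_vec c m) = (if c = 0 then {} else {m})"
  by (auto simp: supp_def coeff_at_term_vec)

lemma const_scale_term_vec: "const c *s term_vec a m = term_vec ((c::'k::comm_ring_1) * a) m"
  by (intro vec_eqI_coeff_at) (simp add: coeff_at_const_scale coeff_at_term_vec)

lemma sum_term_vec:
  assumes "finite B" "supp f \<subseteq> B"
  shows "(\<Sum>m\<in>B. term_vec (coeff_at f m :: 'k::comm_ring_1) m) = f"
  by (intro vec_eqI_coeff_at) (use assms in \<open>auto simp: coeff_at_sum coeff_at_term_vec supp_def\<close>)

lemma homogeneous_of_degree_iff:
  "homogeneous_of_degree \<delta> f \<longleftrightarrow> supp f \<subseteq> {m. mdeg (fst m) = \<delta>}"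
  by (auto simp: homogeneous_of_degree_def)

lemma supp_add: "supp (f + g) \<subseteq> supp f \<union> supp (g :: ('n, 'k::comm_ring_1) mpoly ^ 'd)"
  by (auto simp: supp_def coeff_at_add)

lemma supp_diff: "supp (f - g) \<subseteq> supp f \<union> supp (g :: ('n, 'k::comm_ring_1) mpoly ^ 'd)"
  by (auto simp: supp_def coeff_at_minus)

lemma supp_const_scale: "supp (const c *s f) \<subseteq> supp (f :: ('n, 'k::comm_ring_1) mpoly ^ 'd)"
  by (auto simp: supp_def coeff_at_const_scale)

interpretation coeff_space: vector_space "\<lambda>(c::'k::field) (f::('n, 'k) mpoly ^ 'd). const c *s f"
  by standard (auto simp: intro!: vec_eqI_coeff_at simp: coeff_at_const_scale coeff_at_add algebra_simps mult_single)

lemma mpoly_induct_single_add: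
  fixes p :: "('n, 'k::comm_ring_1) mpoly"
  assumes "P 0" "\<And>u c p. P p \<Longrightarrow> P (Poly_Mapping.single u c + p)"
  shows "P p"
proof -
  have "P (\<Sum>u\<in>A. Poly_Mapping.single u (Poly_Mapping.lookup p u))" for A
    by (induction A rule: infinite_finite_induct) (use assms in auto)
  moreover have "(\<Sum>u\<in>Poly_Mapping.keys p. Poly_Mapping.single u (Poly_Mapping.lookup p u)) = p"
    by (intro poly_mapping_eqI) (auto simp: lookup_sum lookup_single when_def in_keys_iff)
  ultimately show ?thesis by metis
qed

text \<open>Every polynomial is a sum of terms, so closure under scaling needs to be checked for terms
  only, whose effect on coefficients is a mere translation.\<close>

lemma submoduleI_single:
  fixes J :: "(('n, 'k::comm_ring_1) mpoly ^ 'd) set"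
  assumes "0 \<in> J" "\<And>f g. f \<in> J \<Longrightarrow> g \<in> J \<Longrightarrow> f + g \<in> J"
    and "\<And>u c f. f \<in> J \<Longrightarrow> Poly_Mapping.single u c *s f \<in> J"
  shows "free_mod.subspace J"
proof (rule free_mod.subspaceI)
  fix p f assume "f \<in> J"
  then show "p *s f \<in> J"
  proof (induction p rule: mpoly_induct_single_add)
  qed (use assms in \<open>auto simp: vector_sadd_rdistrib\<close>)
qed fact+

section \<open>The dimension of a graded piece of a quotient\<close>

lemma mem_elt_set_plus_iff: "(f::'k::ab_group_add) \<in> g +o J \<longleftrightarrow> f - g \<in> J"
  by (rule set_minus_plus[symmetric])

lemma coset_eq_iff:
  fixes J :: "(('n, 'k::comm_ring_1) mpoly ^ 'd) set"
  assumes "free_mod.subspace J"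
  shows "f +o J = g +o J \<longleftrightarrow> f - g \<in> J"
proof
  assume "f +o J = g +o J"
  moreover have "f \<in> f +o J" using free_mod.subspace_0[OF assms] by (simp add: mem_elt_set_plus_iff)
  ultimately show "f - g \<in> J" by (simp add: mem_elt_set_plus_iff)
next
  assume fg: "f - g \<in> J"
  have "h - f \<in> J \<longleftrightarrow> h - g \<in> J" for h
    using free_mod.subspace_add[OF assms, of "h - f" "f - g"]
      free_mod.subspace_diff[OF assms, of "h - g" "f - g"] fg by auto
  then show "f +o J = g +o J" by (simp add: set_eq_iff mem_elt_set_plus_iff)
qed

lemma submodule_plus_self:
  fixes J :: "(('n, 'k::comm_ring_1) mpoly ^ 'd) set"
  assumes "free_mod.subspace J"
  shows "J + J = J"
  using free_mod.subspace_add[OF assms] free_mod.subspace_0[OF assms]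
  by (auto simp: set_plus_def) (metis add_0)

lemma coset_plus:
  fixes J :: "(('n, 'k::comm_ring_1) mpoly ^ 'd) set"
  assumes "free_mod.subspace J"
  shows "(f +o J) + (g +o J) = (f + g) +o J"
  by (simp add: set_plus_rearrange submodule_plus_self[OF assms])

text \<open>The image of a coset under scaling lies in the expected coset but may be smaller: for \<open>p = 0\<close> it
  is \<open>{0}\<close>. Adding \<open>J\<close> fills the gap.\<close>

lemma coset_scale:
  fixes J :: "(('n, 'k::comm_ring_1) mpoly ^ 'd) set"
  assumes J: "free_mod.subspace J"
  shows "(\<lambda>f. p *s f) ` (f +o J) + J = (p *s f) +o J"
proof (intro equalityI subsetI)
  fix h assume "h \<in> (\<lambda>f. p *s f) ` (f +o J) + J"
  then obtain g j where "g \<in> J" "j \<in> J" and h: "h = p *s (f + g) + j"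
    by (auto simp: set_plus_def elt_set_plus_def)
  then show "h \<in> (p *s f) +o J"
    using free_mod.subspace_add[OF J free_mod.subspace_scale[OF J]]
    by (auto simp: mem_elt_set_plus_iff vector_add_ldistrib)
next
  fix h assume "h \<in> (p *s f) +o J"
  then have "h - p *s f \<in> J" by (simp add: mem_elt_set_plus_iff)
  moreover have "f \<in> f +o J" using free_mod.subspace_0[OF J] by (simp add: mem_elt_set_plus_iff)
  ultimately have "p *s f + (h - p *s f) \<in> (\<lambda>f. p *s f) ` (f +o J) + J"
    by (intro set_plus_intro) auto
  then show "h \<in> (\<lambda>f. p *s f) ` (f +o J) + J" by simp
qed

lemma field_field_ring: "field (field_ring :: 'k::field ring)"
proof (intro cring.cring_fieldI cringI abelian_groupI comm_monoidI)
  show "Units (field_ring :: 'k ring) = carrier field_ring - {\<zero>\<^bsub>field_ring\<^esub>}"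
    by (auto simp: Units_def) (metis left_inverse right_inverse)
  show "\<exists>y\<in>carrier field_ring. y \<oplus>\<^bsub>field_ring\<^esub> x = \<zero>\<^bsub>field_ring\<^esub>" for x :: 'k
    by (auto intro: exI[of _ "- x"])
qed (auto simp: algebra_simps)

lemma vectorspace_quotient_piece:
  fixes J :: "(('n::finite, 'k::field) mpoly ^ 'd) set"
  assumes J: "free_mod.subspace J"
  shows "vectorspace field_ring (quotient_piece J \<delta>)"
proof -
  note [simp] = quotient_piece_def coset_plus[OF J] coset_scale[OF J] homogeneous_of_degree_iff
  have "abelian_group (quotient_piece J \<delta>)"
  proof (rule abelian_groupI, goal_cases)
    case (1 x y)
    then show ?case using supp_add by (force intro!: imageI)
  next
    case 2
    have "0 +o J \<in> carrier (quotient_piece J \<delta>)"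
      unfolding quotient_piece_def by (auto simp: supp_def coeff_at_zero intro!: imageI simp del: set_zero_plus)
    then show ?case by simp
  next
    case (6 x)
    then obtain f where f: "x = f +o J" "supp f \<subseteq> {m. mdeg (fst m) = \<delta>}" by auto
    have "supp (const (- 1) *s f) \<subseteq> {m. mdeg (fst m) = \<delta>}" using supp_const_scale f(2) by blast
    moreover have "const (- 1) *s f + f = 0"
      by (rule vec_eqI_coeff_at) (simp add: coeff_at_add coeff_at_const_scale coeff_at_zero)
    ultimately show ?case unfolding f(1)
      by (intro bexI[of _ "(const (- 1) *s f) +o J"]) (auto intro: imageI)
  next
    case (5 x)
    then obtain f where "x = f +o J" by auto
    then show ?case using coset_plus[OF J, of 0 f] by simp
  qed (auto simp: add_ac)
  moreover have "module_axioms field_ring (quotient_piece J \<delta>)"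
  proof (unfold_locales, goal_cases)
    case (1 a x)
    then show ?case using supp_const_scale by (force intro!: imageI)
  next
    case (2 a b x)
    have "const (a + b) *s f +o J = (const a *s f + const b *s f) +o J" for f :: "('n, 'k) mpoly ^ 'd"
      by (simp add: single_add vector_sadd_rdistrib)
    then show ?case using 2 by auto
  next
    case (3 a x y)
    then show ?case by (auto simp: vector_add_ldistrib)
  next
    case (4 a b x)
    then show ?case by (auto simp: mult_single)
  qed (auto simp: set_plus_rearrange3 submodule_plus_self[OF J])
  moreover interpret field "field_ring :: 'k ring" by (rule field_field_ring)
  have "cring (field_ring :: 'k ring)" by (rule is_cring)
  ultimately show ?thesis
    by (intro vectorspace.intro module.intro field_field_ring)
qed

text \<open>The form in which dimensions are computed below: \<open>B\<close> is a set of monomials whose cosets are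
  a basis of the degree-\<open>\<delta>\<close> piece. The two hypotheses on \<open>B\<close> are independence and generation modulo
  \<open>J\<close>, stated without reference to cosets.\<close>

lemma hilbert_function_eq_card:
  fixes J :: "(('n::finite, 'k::field) mpoly ^ 'd) set"
  assumes J: "free_mod.subspace J" and fin: "finite B"
    and deg: "\<And>m. m \<in> B \<Longrightarrow> mdeg (fst m) = \<delta>"
    and indep: "\<And>h. h \<in> J \<Longrightarrow> supp h \<subseteq> B \<Longrightarrow> h = 0"
    and gen: "\<And>f. homogeneous_of_degree \<delta> f \<Longrightarrow> \<exists>h. supp h \<subseteq> B \<and> f - h \<in> J"
  shows "hilbert_function J \<delta> = card B"
proof -
  let ?V = "quotient_piece J \<delta>"
  interpret V: vectorspace field_ring ?V by (rule vectorspace_quotient_piece[OF J])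
  define c where "c m = term_vec 1 m +o J" for m
  have c_carrier: "c m \<in> carrier ?V" if "m \<in> B" for m
    using deg[OF that] by (auto simp: c_def quotient_piece_def homogeneous_of_degree_iff supp_term_vec)
  have inj: "inj_on c B"
  proof (rule inj_onI)
    fix m m' assume m: "m \<in> B" "m' \<in> B" "c m = c m'"
    then have "term_vec 1 m - term_vec (1::'k) m' = 0"
      using supp_diff[of "term_vec 1 m" "term_vec (1::'k) m'"]
      by (intro indep) (auto simp: c_def coset_eq_iff[OF J] supp_term_vec)
    then have "supp (term_vec (1::'k) m) = supp (term_vec (1::'k) m')" by simp
    then show "m = m'" by (simp add: supp_term_vec)
  qed
  have finsum: "finsum ?V (\<lambda>m. a m \<odot>\<^bsub>?V\<^esub> c m) A = (\<Sum>m\<in>A. term_vec (a m) m) +o J"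
    if "A \<subseteq> B" for a A
    using finite_subset[OF that fin] that
  proof (induction A)
    case empty
    have "\<zero>\<^bsub>?V\<^esub> = J" by (simp add: quotient_piece_def)
    then show ?case by simp
  next
    case (insert m A)
    then have "finsum ?V (\<lambda>m. a m \<odot>\<^bsub>?V\<^esub> c m) (insert m A) =
        a m \<odot>\<^bsub>?V\<^esub> c m \<oplus>\<^bsub>?V\<^esub> finsum ?V (\<lambda>m. a m \<odot>\<^bsub>?V\<^esub> c m) A"
      by (intro V.finsum_insert) (auto intro!: V.smult_closed c_carrier)
    then show ?case using insert
      by (simp add: quotient_piece_def c_def coset_scale[OF J] coset_plus[OF J] const_scale_term_vec)
  qed
  have lincomb: "V.lincomb a (c ` B) = (\<Sum>m\<in>B. term_vec (a (c m)) m) +o J" for a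
  proof -
    have "V.lincomb a (c ` B) = finsum ?V (\<lambda>m. a (c m) \<odot>\<^bsub>?V\<^esub> c m) B"
      unfolding V.lincomb_def by (rule V.finsum_reindex) (auto intro!: V.smult_closed c_carrier inj)
    then show ?thesis using finsum[of B "\<lambda>m. a (c m)"] by simp
  qed
  have coeff: "coeff_at (\<Sum>m\<in>B. term_vec (a m) m) m' = (if m' \<in> B then a m' else 0)" for a :: "_ \<Rightarrow> 'k" and m'
    using fin by (simp add: coeff_at_sum coeff_at_term_vec)
  have supp: "supp (\<Sum>m\<in>B. term_vec (a m) m) \<subseteq> B" for a :: "_ \<Rightarrow> 'k"
    by (auto simp: supp_def coeff split: if_splits)
  have "V.basis (c ` B)"
  proof (subst V.basis_criterion; (intro allI impI)?)
    fix C assume "C \<in> carrier ?V"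
    then obtain f where f: "homogeneous_of_degree \<delta> f" "C = f +o J"
      by (auto simp: quotient_piece_def)
    obtain h where h: "supp h \<subseteq> B" "f - h \<in> J" using gen[OF f(1)] by blast
    show "\<exists>!a. a \<in> c ` B \<rightarrow>\<^sub>E carrier field_ring \<and> V.lincomb a (c ` B) = C"
    proof (rule ex1I, rule conjI)
      \<comment> \<open>Coordinates are indexed by cosets, so the monomial has to be recovered from its coset.\<close>
      let ?a = "restrict (\<lambda>x. coeff_at h (inv_into B c x)) (c ` B)"
      have "(\<Sum>m\<in>B. term_vec (?a (c m)) m) = (\<Sum>m\<in>B. term_vec (coeff_at h m) m)"
        by (rule sum.cong) (auto simp: inv_into_f_f[OF inj])
      also have "\<dots> = h" by (rule sum_term_vec[OF fin h(1)])
      finally show "V.lincomb ?a (c ` B) = C"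
        using h(2) by (simp add: lincomb f(2) coset_eq_iff[OF J] free_mod.subspace_neg[OF J, of "f - h", simplified])
      show "?a \<in> c ` B \<rightarrow>\<^sub>E carrier field_ring" by auto
      fix b assume b: "b \<in> c ` B \<rightarrow>\<^sub>E carrier field_ring \<and> V.lincomb b (c ` B) = C"
      let ?d = "(\<Sum>m\<in>B. term_vec (b (c m)) m) - h"
      have "(\<Sum>m\<in>B. term_vec (b (c m)) m) - f \<in> J"
        using b by (simp add: lincomb f(2) coset_eq_iff[OF J])
      from free_mod.subspace_add[OF J this h(2)] have "?d \<in> J" by simp
      moreover have "supp ?d \<subseteq> B"
        using supp_diff[of "\<Sum>m\<in>B. term_vec (b (c m)) m" h] supp[of "\<lambda>m. b (c m)"] h(1) by auto
      ultimately have "?d = 0" by (rule indep)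
      then have "coeff_at h m = b (c m)" if "m \<in> B" for m
        using coeff[of "\<lambda>m. b (c m)" m] that by simp
      then show "b = ?a"
        using b by (intro extensionalityI[of b "c ` B"]) (auto simp: inv_into_f_f[OF inj] PiE_def)
    qed
  qed (use fin c_carrier in auto)
  then have "V.dim = card (c ` B)" using fin by (intro V.dim_basis) auto
  then show ?thesis by (simp add: hilbert_function_def card_image[OF inj])
qed

section \<open>Graded submodules\<close>

text \<open>For \<open>B\<close> the set of monomials of one degree this is the homogeneous component of that degree.\<close>

definition restrict_supp :: "(('n \<Rightarrow>\<^sub>0 nat) \<times> 'd) set \<Rightarrow> ('n, 'k::comm_ring_1) mpoly ^ 'd \<Rightarrow> ('n, 'k) mpoly ^ 'd" where
  "restrict_supp B f = (\<Sum>m\<in>supp f \<inter> B. term_vec (coeff_at f m) m)"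

lemma coeff_at_restrict_supp: "coeff_at (restrict_supp B f) m = (if m \<in> B then coeff_at f m else 0)"
proof -
  have "coeff_at (restrict_supp B f) m = (if m \<in> supp f \<inter> B then coeff_at f m else 0)"
    by (simp add: restrict_supp_def coeff_at_sum coeff_at_term_vec finite_supp)
  then show ?thesis by (simp add: supp_def)
qed

lemma supp_restrict_supp: "supp (restrict_supp B f) = supp f \<inter> B"
  by (auto simp: supp_def coeff_at_restrict_supp)

abbreviation monomials_of_degree where "monomials_of_degree \<delta> \<equiv> {m. mdeg (fst m) = \<delta>}"

lemma mdeg_add: "mdeg (u + t) = mdeg u + mdeg t"
  by (simp add: mdeg_def lookup_add sum.distrib)

text \<open>Each exponent is bounded by the degree.\<close>

lemma finite_monomials_of_degree:
  "finite (monomials_of_degree \<delta> :: (('n::finite \<Rightarrow>\<^sub>0 nat) \<times> 'd::finite) set)"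
proof -
  have le: "Poly_Mapping.lookup u i \<le> mdeg u" for u :: "'n \<Rightarrow>\<^sub>0 nat" and i
    unfolding mdeg_def by (rule member_le_sum) auto
  have "finite (Poly_Mapping.lookup ` {u :: 'n \<Rightarrow>\<^sub>0 nat. mdeg u = \<delta>})"
    by (rule finite_subset[OF _ finite_PiE[of UNIV "\<lambda>_. {..\<delta>}"]]) (use le in auto)
  then have "finite {u :: 'n \<Rightarrow>\<^sub>0 nat. mdeg u = \<delta>}"
    by (rule finite_imageD) (simp add: inj_on_def lookup_inject)
  then have "finite ({u :: 'n \<Rightarrow>\<^sub>0 nat. mdeg u = \<delta>} \<times> (UNIV :: 'd set))" by simp
  then show ?thesis by (rule rev_finite_subset) auto
qed

lemma degree_part_single_scale:
  "restrict_supp (monomials_of_degree \<delta>) (Poly_Mapping.single u c *s f) =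
    (if mdeg u \<le> \<delta> then Poly_Mapping.single u c *s restrict_supp (monomials_of_degree (\<delta> - mdeg u)) f else 0)"
proof (rule vec_eqI_coeff_at)
  fix m
  show "coeff_at (restrict_supp (monomials_of_degree \<delta>) (Poly_Mapping.single u c *s f)) m =
    coeff_at (if mdeg u \<le> \<delta> then Poly_Mapping.single u c *s restrict_supp (monomials_of_degree (\<delta> - mdeg u)) f else 0) m"
  proof (cases "m \<in> range (shift_monomial u)")
    case True
    then obtain m' where "m = shift_monomial u m'" by auto
    then show ?thesis
      by (auto simp: coeff_at_restrict_supp coeff_at_single_scale_shift coeff_at_zero)
         (auto simp: shift_monomial_def mdeg_add)
  qed (simp add: coeff_at_restrict_supp coeff_at_single_scale_outside coeff_at_zero)
qed

lemma restrict_supp_add: "restrict_supp B (f + g) = restrict_supp B f + restrict_supp B g"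
  by (rule vec_eqI_coeff_at) (simp add: coeff_at_restrict_supp coeff_at_add)

text \<open>The vectors all of whose homogeneous components lie in the span form a submodule, because
  multiplying by a term only translates degrees. It contains the generators, hence the span.\<close>

lemma degree_part_in_span:
  fixes G :: "(('n::finite, 'k::comm_ring_1) mpoly ^ 'd) set"
  assumes G: "\<And>g. g \<in> G \<Longrightarrow> homogeneous g" and f: "f \<in> free_mod.span G"
  shows "restrict_supp (monomials_of_degree \<delta>) f \<in> free_mod.span G"
proof -
  let ?J = "{f. \<forall>\<delta>. restrict_supp (monomials_of_degree \<delta>) f \<in> free_mod.span G}"
  have zero: "restrict_supp B 0 = (0 :: ('n, 'k) mpoly ^ 'd)" for B
    by (simp add: restrict_supp_def supp_def coeff_at_zero)
  have "free_mod.subspace ?J"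
    by (rule submoduleI_single)
      (auto simp: zero restrict_supp_add degree_part_single_scale free_mod.span_zero free_mod.span_add free_mod.span_scale)
  moreover have "G \<subseteq> ?J"
  proof (intro subsetI CollectI allI)
    fix g \<delta>' assume g: "g \<in> G"
    then obtain \<delta>'' where d: "supp g \<subseteq> monomials_of_degree \<delta>''"
      using G by (auto simp: homogeneous_def homogeneous_of_degree_iff)
    show "restrict_supp (monomials_of_degree \<delta>') g \<in> free_mod.span G"
    proof (cases "\<delta>' = \<delta>''")
      case True
      have "restrict_supp (monomials_of_degree \<delta>') g = g"
        by (rule vec_eqI_coeff_at) (use d True in \<open>auto simp: coeff_at_restrict_supp supp_def\<close>)
      then show ?thesis using g by (simp add: free_mod.span_base)
    next
      case False
      then have "supp g \<inter> monomials_of_degree \<delta>' = {}" using d by auto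
      then show ?thesis by (simp add: restrict_supp_def free_mod.span_zero)
    qed
  qed
  ultimately show ?thesis using free_mod.span_minimal[of G ?J] f by blast
qed

section \<open>Finite-dimensional linear algebra\<close>

text \<open>The linear map that sends the monomial \<open>m \<in> M\<close> to \<open>F m\<close> is an endomorphism of the
  space with basis \<open>M\<close>; it has trivial kernel, hence is onto. The argument is the exchange lemma:
  the images of the basis are independent and there are as many of them as monomials in \<open>M\<close>, so no
  further vector supported in \<open>M\<close> is independent of them.\<close>

lemma span_if_kernel_trivial:
  fixes F :: "('n \<Rightarrow>\<^sub>0 nat) \<times> 'd \<Rightarrow> ('n, 'k::field) mpoly ^ 'd"
  assumes fin: "finite M" and supp: "\<And>m. m \<in> M \<Longrightarrow> supp (F m) \<subseteq> M"
    and ker: "\<And>a m. (\<Sum>m\<in>M. const (a m) *s F m) = 0 \<Longrightarrow> m \<in> M \<Longrightarrow> a m = 0"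
    and f: "supp f \<subseteq> M"
  obtains a where "f = (\<Sum>m\<in>M. const (a m) *s F m)"
proof -
  have inj: "inj_on F M"
  proof (rule inj_onI, rule ccontr)
    fix m m' assume m: "m \<in> M" "m' \<in> M" "F m = F m'" "m \<noteq> m'"
    \<comment> \<open>Equal images would make the difference of two distinct basis vectors a kernel element.\<close>
    let ?a = "\<lambda>l. if l = m then 1 else if l = m' then - 1 else 0 :: 'k"
    have "(\<Sum>l\<in>M. const (?a l) *s F l) = (\<Sum>l\<in>{m, m'}. const (?a l) *s F l)"
      by (rule sum.mono_neutral_right) (use m fin in auto)
    also have "\<dots> = 0"
      using m coeff_space.scale_left_distrib[of 1 "- 1" "F m'"] by simp
    finally show False using ker[of ?a m] m by simp
  qed
  have indep: "coeff_space.independent (F ` M)"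
  proof (rule coeff_space.independent_if_scalars_zero)
    fix a x assume "(\<Sum>x\<in>F ` M. const (a x) *s x) = 0" "x \<in> F ` M"
    then show "a x = 0" using ker[of "\<lambda>m. a (F m)"] by (auto simp: sum.reindex[OF inj])
  qed (use fin in simp)
  let ?T = "term_vec (1::'k) ` M"
  have mono: "g \<in> coeff_space.span ?T" if "supp g \<subseteq> M" for g
  proof -
    have "g = (\<Sum>m\<in>M. const (coeff_at g m) *s term_vec 1 m)"
      using sum_term_vec[OF fin that] by (simp add: const_scale_term_vec)
    also have "\<dots> \<in> coeff_space.span ?T"
      by (intro coeff_space.span_sum coeff_space.span_scale coeff_space.span_base imageI)
    finally show ?thesis .
  qed
  have "f \<in> coeff_space.span (F ` M)"
  proof (rule ccontr)
    assume nf: "f \<notin> coeff_space.span (F ` M)"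
    then have "coeff_space.independent (insert f (F ` M))"
      using indep by (rule coeff_space.independent_insertI)
    moreover have "insert f (F ` M) \<subseteq> coeff_space.span ?T" using mono supp f by auto
    ultimately have "card (insert f (F ` M)) \<le> card ?T"
      using coeff_space.independent_span_bound[of ?T "insert f (F ` M)"] fin by simp
    moreover have "f \<notin> F ` M" using nf coeff_space.span_base by blast
    ultimately show False using fin card_image_le[of M "term_vec (1::'k)"] by (simp add: card_image[OF inj])
  qed
  then obtain a where "f = (\<Sum>x\<in>F ` M. const (a x) *s x)"
    using fin by (auto simp: coeff_space.span_finite)
  then show ?thesis using that[of "\<lambda>m. a (F m)"] by (simp add: sum.reindex[OF inj])
qed

section \<open>Initial monomials\<close>

locale initial_setup =
  fixes v :: "'k::field \<Rightarrow> ereal" and w :: "real ^ 'n::finite"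
    and prec :: "('n \<Rightarrow>\<^sub>0 nat) \<Rightarrow> ('n \<Rightarrow>\<^sub>0 nat) \<Rightarrow> bool"
  assumes valuation: "valuation v" and monomial_order: "monomial_order prec"
begin

text \<open>On nonzero elements the valuation is real-valued, and the real number is easier to compare
  than the extended one; \<open>val 0\<close> is a meaningless default, so only values of
  nonzero elements are compared.\<close>

definition val :: "'k \<Rightarrow> real" where "val a = real_of_ereal (v a)"

lemma v_eq_val: "a \<noteq> 0 \<Longrightarrow> v a = ereal (val a)"
  using valuation by (auto simp: valuation_def val_def ereal_real)

lemma val_mult: "a \<noteq> 0 \<Longrightarrow> b \<noteq> 0 \<Longrightarrow> val (a * b) = val a + val b"
  using valuation v_eq_val[of a] v_eq_val[of b] v_eq_val[of "a * b"] by (simp add: valuation_def)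

lemma val_minus: "val (- a) = val a"
proof (cases "a = 0")
  case False
  have "val 1 = val 1 + val 1" "val 1 = val (- 1) + val (- 1)"
    using val_mult[of 1 1] val_mult[of "- 1" "- 1"] by simp_all
  then show ?thesis using False val_mult[of "- 1" a] by simp
qed simp

text \<open>The ultrametric inequality for finite sums. Zero summands are exempt from the bound because
  their true valuation is infinite.\<close>

lemma val_sum_greater:
  assumes "\<And>s. s \<in> A \<Longrightarrow> g s \<noteq> 0 \<Longrightarrow> x < val (g s)" "(\<Sum>s\<in>A. g s) \<noteq> 0"
  shows "x < val (\<Sum>s\<in>A. g s)"
proof -
  have v_zero: "v 0 = \<infinity>" using valuation by (metis valuation_def)
  have "ereal x < v (\<Sum>s\<in>A. g s)"
    using assms(1)
  proof (induction A rule: infinite_finite_induct)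
    case (insert s A)
    have "ereal x < v (g s)"
      using v_zero insert.prems[of s] v_eq_val[of "g s"] by (cases "g s = 0") auto
    moreover have "min (v (g s)) (v (\<Sum>s\<in>A. g s)) \<le> v (g s + (\<Sum>s\<in>A. g s))"
      using valuation by (simp add: valuation_def)
    ultimately show ?case using insert by (simp add: min_def split: if_splits)
  qed (simp_all add: v_zero)
  then show ?thesis using v_eq_val[OF assms(2)] by simp
qed

definition wdot :: "('n \<Rightarrow>\<^sub>0 nat) \<Rightarrow> real" where
  "wdot u = (\<Sum>i\<in>UNIV. w $ i * real (Poly_Mapping.lookup u i))"

lemma wdot_add: "wdot (u + t) = wdot u + wdot t"
  by (simp add: wdot_def lookup_add sum.distrib algebra_simps)

text \<open>The relational form of being the initial monomial: every other monomial of \<open>f\<close> has strictly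
  larger weight, or the same weight and a smaller place in the order. It spares the description
  operator and the minimum over the support; the two notions are
  identified in \<open>initial_monomial_eqI\<close>.\<close>

definition is_initial :: "('n, 'k) mpoly ^ 'd::{finite,linorder} \<Rightarrow> ('n \<Rightarrow>\<^sub>0 nat) \<times> 'd \<Rightarrow> bool" where
  "is_initial f m \<longleftrightarrow> m \<in> supp f \<and> (\<forall>m'\<in>supp f. m' \<noteq> m \<longrightarrow>
     val (coeff_at f m) + wdot (fst m) < val (coeff_at f m') + wdot (fst m') \<or>
     val (coeff_at f m) + wdot (fst m) = val (coeff_at f m') + wdot (fst m') \<and> vec_monomial_less prec m' m)"

lemma vec_monomial_less_trans:
  "vec_monomial_less prec l m \<Longrightarrow> vec_monomial_less prec m n \<Longrightarrow> vec_monomial_less prec l n"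
  using monomial_order by (auto simp: vec_monomial_less_def monomial_order_def dest: transpD)

lemma vec_monomial_less_irrefl: "\<not> vec_monomial_less prec m m"
  using monomial_order by (auto simp: vec_monomial_less_def monomial_order_def dest: irreflpD)

lemma vec_monomial_less_total: "l \<noteq> m \<Longrightarrow> vec_monomial_less prec l m \<or> vec_monomial_less prec m l"
  using monomial_order by (auto simp: vec_monomial_less_def monomial_order_def prod_eq_iff dest: totalpD)

lemma vec_monomial_less_shift:
  "vec_monomial_less prec l m \<Longrightarrow> vec_monomial_less prec (shift_monomial u l) (shift_monomial u m)"
  using monomial_order by (auto simp: vec_monomial_less_def monomial_order_def shift_monomial_def add.commute[of u])

lemma weight_eq: "m \<in> supp f \<Longrightarrow> weight v w f m = ereal (val (coeff_at f m) + wdot (fst m))"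
  by (simp add: weight_def supp_def v_eq_val wdot_def)

lemma is_initial_exists:
  assumes "f \<noteq> 0" shows "\<exists>m. is_initial f m"
proof -
  let ?W = "\<lambda>m. val (coeff_at f m) + wdot (fst m)"
  have fin: "finite (supp f)" and ne: "supp f \<noteq> {}" using assms by (auto simp: finite_supp supp_eq_empty_iff)
  define A where "A = {m \<in> supp f. ?W m = Min (?W ` supp f)}"
  have "Min (?W ` supp f) \<in> ?W ` supp f" using fin ne by (intro Min_in) auto
  then obtain l where "l \<in> supp f" "?W l = Min (?W ` supp f)" by (metis (no_types, lifting) imageE)
  then have "A \<noteq> {}" unfolding A_def by blast
  moreover have "finite A" using fin by (simp add: A_def)
  moreover have "asymp_on A (vec_monomial_less prec)"
    using vec_monomial_less_trans vec_monomial_less_irrefl by (metis asymp_onI)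
  moreover have "transp_on A (vec_monomial_less prec)"
    using vec_monomial_less_trans by (metis transp_onI)
  ultimately obtain m where m: "m \<in> A" "\<And>l. l \<in> A \<Longrightarrow> l \<noteq> m \<Longrightarrow> \<not> vec_monomial_less prec m l"
    using Finite_Set.bex_max_element[of A "vec_monomial_less prec"] by blast
  have "?W m < ?W l \<or> ?W m = ?W l \<and> vec_monomial_less prec l m" if "l \<in> supp f" "l \<noteq> m" for l
  proof (cases "l \<in> A")
    case True
    then show ?thesis using m that vec_monomial_less_total[of l m] by (auto simp: A_def)
  next
    case False
    have "Min (?W ` supp f) \<le> ?W l" using fin that by (intro Min_le) auto
    then show ?thesis using False m(1) that by (auto simp: A_def)
  qed
  moreover have "m \<in> supp f" using m(1) unfolding A_def by blast
  ultimately show ?thesis unfolding is_initial_def by blast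
qed

lemma initial_monomial_eqI:
  assumes "is_initial f m" shows "initial_monomial v w prec f = m"
proof -
  have m: "m \<in> supp f" using assms by (simp add: is_initial_def)
  have min: "min_weight v w f = weight v w f m"
    unfolding min_weight_def
  proof (rule Min_eqI)
    fix y assume "y \<in> weight v w f ` supp f"
    then obtain l where l: "l \<in> supp f" "y = weight v w f l" by auto
    then show "weight v w f m \<le> y"
      using assms m by (cases "l = m") (auto simp: is_initial_def weight_eq)
  qed (use m in \<open>simp_all add: finite_supp\<close>)
  have max: "l = m \<or> vec_monomial_less prec l m" if "l \<in> supp f" "weight v w f l = weight v w f m" for l
    using assms that m by (auto simp: is_initial_def weight_eq)
  show ?thesis unfolding initial_monomial_def min
    by (rule the_equality)
      (use m max vec_monomial_less_trans[of m _ m] vec_monomial_less_irrefl[of m] in blast)+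
qed

text \<open>Multiplication by \<open>c x\<^sup>u\<close> adds the constant \<open>val c + wdot u\<close> to all weights and
  translates all monomials by \<open>u\<close>, so neither comparison changes.\<close>

lemma is_initial_single_scale:
  assumes m: "is_initial f m" and c: "c \<noteq> 0"
  shows "is_initial (Poly_Mapping.single u c *s f) (shift_monomial u m)"
proof -
  have supp: "l \<in> supp (Poly_Mapping.single u c *s f) \<longleftrightarrow> l \<in> shift_monomial u ` supp f" for l
  proof (cases "l \<in> range (shift_monomial u)")
    case True
    then obtain l' where l': "l = shift_monomial u l'" by auto
    have "inj (shift_monomial u)" by (auto simp: inj_def shift_monomial_def prod_eq_iff)
    then show ?thesis using c unfolding l' inj_image_mem_iff[OF \<open>inj (shift_monomial u)\<close>] by (simp add: supp_def coeff_at_single_scale_shift)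
  next
    case False
    then show ?thesis using coeff_at_single_scale_outside[of l u c f] by (auto simp: supp_def)
  qed
  have W: "val (coeff_at (Poly_Mapping.single u c *s f) (shift_monomial u l)) + wdot (fst (shift_monomial u l)) =
      val c + wdot u + (val (coeff_at f l) + wdot (fst l))" if "l \<in> supp f" for l
    using that c by (simp add: supp_def coeff_at_single_scale_shift val_mult) (simp add: shift_monomial_def wdot_add)
  show ?thesis unfolding is_initial_def
  proof (intro conjI ballI impI)
    show "shift_monomial u m \<in> supp (Poly_Mapping.single u c *s f)" using m by (simp add: supp is_initial_def)
    fix m' assume "m' \<in> supp (Poly_Mapping.single u c *s f)" "m' \<noteq> shift_monomial u m"
    then obtain l where l: "l \<in> supp f" "m' = shift_monomial u l" "l \<noteq> m" by (auto simp: supp)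
    show "val (coeff_at (Poly_Mapping.single u c *s f) (shift_monomial u m)) + wdot (fst (shift_monomial u m))
          < val (coeff_at (Poly_Mapping.single u c *s f) m') + wdot (fst m') \<or>
        val (coeff_at (Poly_Mapping.single u c *s f) (shift_monomial u m)) + wdot (fst (shift_monomial u m))
          = val (coeff_at (Poly_Mapping.single u c *s f) m') + wdot (fst m') \<and>
        vec_monomial_less prec m' (shift_monomial u m)"
      using m l(1,3) W[of m] W[of l] vec_monomial_less_shift[of l m u]
      unfolding is_initial_def l(2) by auto
  qed
qed

text \<open>Dropping terms other than the initial one leaves it initial. This makes it possible to pass
  from an element to one of its homogeneous components.\<close>

lemma is_initial_subsupp:
  assumes "is_initial f m" "m \<in> supp g" "supp g \<subseteq> supp f" "\<And>l. l \<in> supp g \<Longrightarrow> coeff_at g l = coeff_at f l"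
  shows "is_initial g m"
  using assms by (auto simp: is_initial_def subset_iff)

text \<open>Distinct initial monomials force independence, although the coefficients need not form a
  triangular matrix in any order. Let \<open>h\<close> collect the initial terms of the summands \<open>a m F m\<close>, and let \<open>p\<close> be the initial monomial
  of \<open>h\<close>. The summand at \<open>p\<close> contributes a coefficient of a certain valuation to \<open>p\<close>, while every
  other summand contributes one of strictly larger valuation: passing from \<open>p\<close> to \<open>m\<close> in \<open>h\<close> and then
  from \<open>m\<close> to \<open>p\<close> in \<open>F m\<close> never lowers the weight, and if both steps kept it then \<open>m\<close> would be
  both below and above \<open>p\<close> in the order. Hence the coefficient of the sum at \<open>p\<close> cannot
  cancel.\<close>

lemma trivial_if_combination_zero:
  fixes F :: "('n \<Rightarrow>\<^sub>0 nat) \<times> 'd \<Rightarrow> ('n, 'k) mpoly ^ 'd::{finite,linorder}"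
  assumes fin: "finite M" and F: "\<And>m. m \<in> M \<Longrightarrow> is_initial (F m) m"
    and zero: "(\<Sum>m\<in>M. const (a m) *s F m) = 0" and "s \<in> M"
  shows "a s = 0"
proof (rule ccontr)
  assume as: "a s \<noteq> 0"
  define b where "b m = a m * coeff_at (F m) m" for m
  define h where "h = (\<Sum>m\<in>M. term_vec (b m) m)"
  have coeff_h: "coeff_at h m = (if m \<in> M then b m else 0)" for m
    using fin by (simp add: h_def coeff_at_sum coeff_at_term_vec)
  have F0: "coeff_at (F m) m \<noteq> 0" if "m \<in> M" for m
    using F[OF that] by (simp add: is_initial_def supp_def)
  have "coeff_at h s \<noteq> 0" using as \<open>s \<in> M\<close> F0 by (simp add: coeff_h b_def)
  then have "h \<noteq> 0" by (auto simp: coeff_at_zero)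
  then obtain p where p: "is_initial h p" using is_initial_exists by blast
  then have pM: "p \<in> M" and bp: "b p \<noteq> 0" by (auto simp: is_initial_def supp_def coeff_h split: if_splits)
  have "0 = (\<Sum>m\<in>M. a m * coeff_at (F m) p)"
    using arg_cong[OF zero, of "\<lambda>g. coeff_at g p"] by (simp add: coeff_at_sum coeff_at_const_scale coeff_at_zero)
  also have "\<dots> = b p + (\<Sum>m\<in>M - {p}. a m * coeff_at (F m) p)"
    using fin pM by (simp add: sum.remove b_def)
  finally have eq: "(\<Sum>m\<in>M - {p}. a m * coeff_at (F m) p) = - b p" by (simp add: eq_neg_iff_add_eq_0 add.commute)
  \<comment> \<open>By the ultrametric inequality it suffices to compare single summands with \<open>b p\<close>.\<close>
  have "val (b p) < val (\<Sum>m\<in>M - {p}. a m * coeff_at (F m) p)"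
  proof (rule val_sum_greater)
    fix m assume m: "m \<in> M - {p}" and "a m * coeff_at (F m) p \<noteq> 0"
    then have am: "a m \<noteq> 0" and cp: "coeff_at (F m) p \<noteq> 0" by auto
    have bm: "b m \<noteq> 0" using am F0 m by (simp add: b_def)
    have 1: "val (b p) + wdot (fst p) < val (b m) + wdot (fst m) \<or>
       val (b p) + wdot (fst p) = val (b m) + wdot (fst m) \<and> vec_monomial_less prec m p"
    proof -
      have "m \<in> supp h" using m bm by (simp add: supp_def coeff_h)
      then show ?thesis using p m pM by (auto simp: is_initial_def coeff_h)
    qed
    have 2: "val (coeff_at (F m) m) + wdot (fst m) < val (coeff_at (F m) p) + wdot (fst p) \<or>
       val (coeff_at (F m) m) + wdot (fst m) = val (coeff_at (F m) p) + wdot (fst p) \<and> vec_monomial_less prec p m"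
    proof -
      have "p \<in> supp (F m)" using cp by (simp add: supp_def)
      then show ?thesis using F[of m] m by (auto simp: is_initial_def)
    qed
    have 3: "val (b m) = val (a m) + val (coeff_at (F m) m)"
      "val (a m * coeff_at (F m) p) = val (a m) + val (coeff_at (F m) p)"
      using am cp F0 m by (auto simp: b_def val_mult)
    show "val (b p) < val (a m * coeff_at (F m) p)"
      using 1 2 3 vec_monomial_less_trans[of m p m] vec_monomial_less_irrefl[of m] by auto
  qed (simp add: eq bp)
  then show False by (simp add: eq val_minus)
qed

section \<open>Standard monomials and the Hilbert functions\<close>

definition initial_monomials :: "(('n, 'k) mpoly ^ 'd::{finite,linorder}) set \<Rightarrow> (('n \<Rightarrow>\<^sub>0 nat) \<times> 'd) set" where
  "initial_monomials I = {m. \<exists>f\<in>I. is_initial f m}"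

lemma initial_term_eq: "is_initial f m \<Longrightarrow> initial_term v w prec f = term_vec (coeff_at f m) m"
  using initial_monomial_eqI[of f m] by (auto simp: initial_term_def is_initial_def supp_def coeff_at_zero)

text \<open>A submodule spanned by terms with invertible coefficients is determined by its set of
  monomials. Here that set is \<open>initial_monomials I\<close>, because it is already closed under
  multiplication by monomials.\<close>

lemma initial_submodule_eq:
  fixes I :: "(('n, 'k) mpoly ^ 'd::{finite,linorder}) set"
  assumes I: "free_mod.subspace I"
  shows "initial_submodule v w prec I = {g. supp g \<subseteq> initial_monomials I}"
proof
  have shift: "shift_monomial u m \<in> initial_monomials I" if m: "m \<in> initial_monomials I" for u m
  proof -
    obtain f where "f \<in> I" "is_initial f m" using m by (auto simp: initial_monomials_def)
    then show ?thesis
      using is_initial_single_scale[of f m 1 u] free_mod.subspace_scale[OF I, of f] by (auto simp: initial_monomials_def)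
  qed
  have "free_mod.subspace {g :: ('n, 'k) mpoly ^ 'd::{finite,linorder}. supp g \<subseteq> initial_monomials I}"
  proof (rule submoduleI_single; clarify?)
    fix u c m and f :: "('n, 'k) mpoly ^ 'd::{finite,linorder}"
    assume f: "supp f \<subseteq> initial_monomials I" and m: "m \<in> supp (Poly_Mapping.single u c *s f)"
    then obtain l where l: "m = shift_monomial u l"
      using coeff_at_single_scale_outside[of m u c f] by (force simp: supp_def)
    then have "l \<in> supp f" using m by (auto simp: supp_def coeff_at_single_scale_shift)
    then show "m \<in> initial_monomials I" using f shift[of l u] l by blast
  next
    fix f g :: "('n, 'k) mpoly ^ 'd::{finite,linorder}" and m
    assume "supp f \<subseteq> initial_monomials I" "supp g \<subseteq> initial_monomials I" "m \<in> supp (f + g)"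
    then show "m \<in> initial_monomials I" using supp_add[of f g] by blast
  qed (auto simp: supp_def coeff_at_zero)
  moreover have "initial_term v w prec f \<in> {g. supp g \<subseteq> initial_monomials I}" if "f \<in> I" for f
  proof (cases "f = 0")
    case False
    then obtain m where "is_initial f m" using is_initial_exists by blast
    then show ?thesis using that by (auto simp: initial_term_eq supp_term_vec initial_monomials_def)
  qed (simp add: initial_term_def supp_def coeff_at_zero)
  ultimately show "initial_submodule v w prec I \<subseteq> {g. supp g \<subseteq> initial_monomials I}"
    unfolding initial_submodule_def by (intro free_mod.span_minimal) auto
next
  show "{g. supp g \<subseteq> initial_monomials I} \<subseteq> initial_submodule v w prec I"
  proof
    fix g :: "('n, 'k) mpoly ^ 'd::{finite,linorder}"
    assume g: "g \<in> {g. supp g \<subseteq> initial_monomials I}"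
    have "term_vec (coeff_at g m) m \<in> initial_submodule v w prec I" if m: "m \<in> supp g" for m
    proof -
      obtain f where f: "f \<in> I" "is_initial f m" using g m unfolding initial_monomials_def by blast
      then have "coeff_at f m \<noteq> 0" by (simp add: is_initial_def supp_def)
      then have "term_vec (coeff_at g m) m = const (coeff_at g m / coeff_at f m) *s initial_term v w prec f"
        using f by (simp add: initial_term_eq const_scale_term_vec)
      also have "\<dots> \<in> initial_submodule v w prec I"
        unfolding initial_submodule_def by (intro free_mod.span_scale free_mod.span_base imageI f)
      finally show ?thesis .
    qed
    then have "(\<Sum>m\<in>supp g. term_vec (coeff_at g m) m) \<in> initial_submodule v w prec I"
      unfolding initial_submodule_def by (intro free_mod.span_sum)
    then show "g \<in> initial_submodule v w prec I" by (simp add: sum_term_vec finite_supp)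
  qed
qed

text \<open>For the initial submodule the monomials outside it are a basis of the quotient for trivial
  reasons: deleting the terms in the submodule is the reduction.\<close>

lemma hilbert_function_initial_submodule:
  fixes I :: "(('n, 'k) mpoly ^ 'd::{finite,linorder}) set"
  assumes I: "free_mod.subspace I"
  shows "hilbert_function (initial_submodule v w prec I) \<delta> = card (monomials_of_degree \<delta> - initial_monomials I)"
proof (rule hilbert_function_eq_card)
  show "free_mod.subspace (initial_submodule v w prec I)"
    unfolding initial_submodule_def by (rule free_mod.subspace_span)
  fix f :: "('n, 'k) mpoly ^ 'd::{finite,linorder}" assume f: "homogeneous_of_degree \<delta> f"
  let ?h = "restrict_supp (- initial_monomials I) f"
  have "supp (f - ?h) \<subseteq> initial_monomials I"
    by (auto simp: supp_def coeff_at_minus coeff_at_restrict_supp split: if_splits)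
  moreover have "supp ?h \<subseteq> monomials_of_degree \<delta> - initial_monomials I"
    using f by (auto simp: supp_restrict_supp homogeneous_of_degree_iff)
  ultimately show "\<exists>h. supp h \<subseteq> monomials_of_degree \<delta> - initial_monomials I \<and> f - h \<in> initial_submodule v w prec I"
    by (auto simp: initial_submodule_eq[OF I])
next
  fix h assume "h \<in> initial_submodule v w prec I" "supp h \<subseteq> monomials_of_degree \<delta> - initial_monomials I"
  then have "supp h = {}" by (auto simp: initial_submodule_eq[OF I])
  then show "h = 0" by (simp add: supp_eq_empty_iff)
qed (auto simp: finite_monomials_of_degree)

text \<open>The same monomials are a basis of the quotient by \<open>I\<close> itself. Independence: a nonzero
  element of \<open>I\<close> contains its initial monomial. Generation: reducing \<open>f\<close> step by step need not
  terminate, since the remainders may have ever larger weights, so a dimension count replaces the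
  division algorithm. In degree \<open>\<delta>\<close> choose for every initial monomial \<open>m\<close> a homogeneous
  \<open>F m \<in> I\<close> with this initial monomial, and for every other \<open>m\<close> the monomial itself. These
  vectors have distinct initial monomials, hence are independent, and there are as many as monomials of
  degree \<open>\<delta>\<close>; so \<open>f\<close> is a combination of them, and modulo \<open>I\<close> only the second kind remains.\<close>

lemma hilbert_function_graded_submodule:
  fixes I :: "(('n, 'k) mpoly ^ 'd::{finite,linorder}) set"
  assumes I: "free_mod.subspace I"
    and graded: "\<And>f \<delta>. f \<in> I \<Longrightarrow> restrict_supp (monomials_of_degree \<delta>) f \<in> I"
  shows "hilbert_function I \<delta> = card (monomials_of_degree \<delta> - initial_monomials I)"
proof (rule hilbert_function_eq_card[OF I])
  let ?M = "monomials_of_degree \<delta> :: (('n \<Rightarrow>\<^sub>0 nat) \<times> 'd::{finite,linorder}) set"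
  fix f :: "('n, 'k) mpoly ^ 'd::{finite,linorder}" assume f: "homogeneous_of_degree \<delta> f"
  have "\<exists>g. is_initial g m \<and> supp g \<subseteq> ?M \<and> (m \<in> initial_monomials I \<longrightarrow> g \<in> I) \<and> (m \<notin> initial_monomials I \<longrightarrow> g = term_vec 1 m)"
    if m: "m \<in> ?M" for m
  proof (cases "m \<in> initial_monomials I")
    case True
    then obtain g where g: "g \<in> I" "is_initial g m" by (auto simp: initial_monomials_def)
    \<comment> \<open>The component of \<open>g\<close> in the degree of \<open>m\<close> still has initial monomial \<open>m\<close> and lies in \<open>I\<close>.\<close>
    have "is_initial (restrict_supp ?M g) m"
      by (rule is_initial_subsupp[OF g(2)])
        (use g(2) m in \<open>auto simp: supp_restrict_supp coeff_at_restrict_supp is_initial_def\<close>)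
    then show ?thesis using True graded[OF g(1)] by (auto simp: supp_restrict_supp)
  next
    case False
    then show ?thesis using m by (auto simp: is_initial_def supp_term_vec)
  qed
  then obtain F where F: "\<And>m. m \<in> ?M \<Longrightarrow> is_initial (F m) m" "\<And>m. m \<in> ?M \<Longrightarrow> supp (F m) \<subseteq> ?M"
     "\<And>m. m \<in> ?M \<Longrightarrow> m \<in> initial_monomials I \<Longrightarrow> F m \<in> I"
     "\<And>m. m \<in> ?M \<Longrightarrow> m \<notin> initial_monomials I \<Longrightarrow> F m = term_vec 1 m" by metis
  obtain a where a: "f = (\<Sum>m\<in>?M. const (a m) *s F m)"
  proof (rule span_if_kernel_trivial[of ?M F f])
    show "a m = 0" if "(\<Sum>m\<in>?M. const (a m) *s F m) = 0" "m \<in> ?M" for a m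
      using trivial_if_combination_zero[OF finite_monomials_of_degree F(1) that] .
    show "supp f \<subseteq> ?M" using f by (simp only: homogeneous_of_degree_iff)
  qed (use F(2) in \<open>simp_all add: finite_monomials_of_degree\<close>)
  let ?h = "\<Sum>m\<in>?M - initial_monomials I. const (a m) *s F m"
  have h: "?h = (\<Sum>m\<in>?M - initial_monomials I. term_vec (a m) m)"
    using F(4) by (intro sum.cong) (auto simp: const_scale_term_vec)
  have "supp ?h \<subseteq> ?M - initial_monomials I"
    unfolding h
    by (auto simp: supp_def coeff_at_sum coeff_at_term_vec finite_monomials_of_degree split: if_splits)
  moreover have "f - ?h = (\<Sum>m\<in>?M \<inter> initial_monomials I. const (a m) *s F m)"
    unfolding a by (subst sum.Int_Diff[of ?M _ "initial_monomials I"]) (simp_all add: finite_monomials_of_degree)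
  moreover have "\<dots> \<in> I"
    using F(3) by (intro free_mod.subspace_sum[OF I] free_mod.subspace_scale[OF I]) auto
  ultimately show "\<exists>h. supp h \<subseteq> ?M - initial_monomials I \<and> f - h \<in> I"
    by (intro exI[of _ ?h]) simp
next
  fix h assume h: "h \<in> I" "supp h \<subseteq> monomials_of_degree \<delta> - initial_monomials I"
  show "h = 0"
  proof (rule ccontr)
    assume "h \<noteq> 0"
    then obtain m where "is_initial h m" using is_initial_exists by blast
    then show False using h by (auto simp: is_initial_def initial_monomials_def)
  qed
qed (auto simp: finite_monomials_of_degree)

end

theorem theorem5p2:
  fixes v :: "'k::field \<Rightarrow> ereal"
    and w :: "real ^ 'n"
    and prec :: "('n \<Rightarrow>\<^sub>0 nat) \<Rightarrow> ('n \<Rightarrow>\<^sub>0 nat) \<Rightarrow> bool"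
    and I :: "(('n, 'k) mpoly ^ 'd::{finite,linorder}) set"
  assumes "valuation v"
    and "\<And>i. w $ i \<in> value_group v"
    and "monomial_order prec"
    and "\<exists>G. (\<forall>g\<in>G. homogeneous g) \<and> I = free_mod.span G"
  shows "hilbert_function I = hilbert_function (initial_submodule v w prec I)"
proof
  interpret initial_setup v w prec by standard fact+
  obtain G where G: "\<And>g. g \<in> G \<Longrightarrow> homogeneous g" and I_eq: "I = free_mod.span G"
    using assms(4) by blast
  have I: "free_mod.subspace I" unfolding I_eq by (rule free_mod.subspace_span)
  show "hilbert_function I \<delta> = hilbert_function (initial_submodule v w prec I) \<delta>" for \<delta>
    using hilbert_function_graded_submodule[OF I] degree_part_in_span[OF G]
    by (simp add: I_eq hilbert_function_initial_submodule[OF I, unfolded I_eq])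
qed

end
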